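(* Let $S\in M_{2n}(\mathbb{C})$ be symplectic with $\lambda_1,\lambda_1^{-1}\in\sigma(S)$ and let $\mu\in\mathbb{C}\setminus\{0\}$ be given. Let $x_1,x_2\in\mathbb{C}^{2n}$ be eigenvectors of $S$ for $\lambda_1$ and $\lambda_1^{-1}$, respectively, with $\|x_1\|_2=\|x_2\|_2=1$ and $x_1^TJx_2\neq 0$, and let $$X = \frac{1}{\sqrt{x_1^TJx_2}}\,[\,x_1\;\;x_2\,]\in M_{2n\times 2}(\mathbb{C}).$$ Define $\Phi := \dfrac{1}{|x_1^TJx_2|\cdot\|S\|_F}$ (which equals $\kappa(S,\lambda_1)/\|S\|_F$ if $\lambda_1$ is a simple eigenvalue of $S$). Let $$R_1 = \begin{bmatrix} 0 & \lambda_1^{-1}(\mu-\lambda_1)\\ \mu^{-1}(\mu-\lambda_1) & 0\end{bmatrix},\qquad R_2 = \begin{bmatrix} 0 & \mu^{-1}(\lambda_1^{-1}-\mu)\\ \lambda_1(\lambda_1^{-1}-\mu) & 0\end{bmatrix}.$$ (i) Let $\hat{S}_1 = S+XR_1X^TJ^TS$. If $\mathrm{Re}(\lambda_1\mu)\le 0$, then $$\frac{|\lambda_1-\mu|}{|\lambda_1|}\big(|\lambda_1+\mu^{-1}|\,\Phi\big)\le \frac{\|\hat{S}_1-S\|_F}{\|S\|_F}\le \frac{|\lambda_1-\mu|}{|\lambda_1|}\big(|\lambda_1-\mu^{-1}|\,\Phi\big).$$ If $\mathrm{Re}(\lambda_1\mu)>0$, the upper and lower bounds interchange, i.e. $$\frac{|\lambda_1-\mu|}{|\lambda_1|}\big(|\lambda_1-\mu^{-1}|\,\Phi\big)\le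 \frac{\|\hat{S}_1-S\|_F}{\|S\|_F}\le \frac{|\lambda_1-\mu|}{|\lambda_1|}\big(|\lambda_1+\mu^{-1}|\,\Phi\big).$$ (ii) Let $\hat{S}_2 = S+XR_2X^TJ^TS$. If $\mathrm{Re}(\overline{\lambda_1}\mu)\le 0$, then $$\frac{|\lambda_1^{-1}-\mu|}{|\lambda_1^{-1}|}\big(|\lambda_1^{-1}+\mu^{-1}|\,\Phi\big)\le \frac{\|\hat{S}_2-S\|_F}{\|S\|_F}\le \frac{|\lambda_1^{-1}-\mu|}{|\lambda_1^{-1}|}\big(|\lambda_1^{-1}-\mu^{-1}|\,\Phi\big).$$ If $\mathrm{Re}(\overline{\lambda_1}\mu)>0$, the upper and lower bounds interchange, i.e. $$\frac{|\lambda_1^{-1}-\mu|}{|\lambda_1^{-1}|}\big(|\lambda_1^{-1}-\mu^{-1}|\,\Phi\big)\le \frac{\|\hat{S}_2-S\|_F}{\|S\|_F}\le \frac{|\lambda_1^{-1}-\mu|}{|\lambda_1^{-1}|}\big(|\lambda_1^{-1}+\mu^{-1}|\,\Phi\big).$$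
   Context: $M_{m\times n}(\mathbb{C})$ is the set of complex $m\times n$ matrices, $M_n(\mathbb{C})=M_{n\times n}(\mathbb{C})$, $\sigma(S)$ is the spectrum, $^T$ is the transpose without conjugation, $^H$ is the conjugate transpose, $\|\cdot\|_F$ is the Frobenius norm. $J=J_{2n} = \begin{bmatrix} 0 & I_n \\ -I_n & 0\end{bmatrix}$; $S\in M_{2n}(\mathbb{C})$ is symplectic if $S^TJS=J$. $\sqrt{x_1^TJx_2}$ is a fixed complex square root. For a simple eigenvalue $\lambda$ (algebraic multiplicity one) of a square complex matrix $A$, its condition number is $\kappa(A,\lambda) = \|u\|_2\|v\|_2/|v^Hu|$, where $u,v$ are right and left eigenvectors of $A$ for $\lambda$, i.e. $Au=\lambda u$ and $v^HA=\lambda v^H$. *)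

theory Defs
  imports "Jordan_Normal_Form.Spectral_Radius"
begin

definition symp_J :: "nat \<Rightarrow> complex mat" where
  "symp_J n = four_block_mat (0\<^sub>m n n) (1\<^sub>m n) (- 1\<^sub>m n) (0\<^sub>m n n)"

definition symplectic :: "nat \<Rightarrow> complex mat \<Rightarrow> bool" where
  "symplectic n S \<longleftrightarrow>
     S \<in> carrier_mat (2 * n) (2 * n) \<and> transpose_mat S * symp_J n * S = symp_J n"

definition l2_norm_vec :: "complex vec \<Rightarrow> real" where
  "l2_norm_vec v = sqrt (\<Sum>i<dim_vec v. (cmod (v $ i))\<^sup>2)"

definition frob_norm :: "complex mat \<Rightarrow> real" where
  "frob_norm A = sqrt (\<Sum>i<dim_row A. \<Sum>j<dim_col A. (cmod (A $$ (i, j)))\<^sup>2)"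

definition adjoint_row :: "complex vec \<Rightarrow> complex mat" where
  "adjoint_row v = mat_of_rows (dim_vec v) [conjugate v]"

definition left_eigenvector :: "complex mat \<Rightarrow> complex vec \<Rightarrow> complex \<Rightarrow> bool" where
  "left_eigenvector A v k \<longleftrightarrow>
     v \<in> carrier_vec (dim_row A) \<and> v \<noteq> 0\<^sub>v (dim_row A) \<and>
     adjoint_row v * A = k \<cdot>\<^sub>m adjoint_row v"

definition simple_eigenvalue :: "complex mat \<Rightarrow> complex \<Rightarrow> bool" where
  "simple_eigenvalue A k \<longleftrightarrow> order k (char_poly A) = 1"

(* For a simple eigenvalue the quotient does not depend on the choice of the two
   eigenvectors; for other k the value of the definite description is unspecified. *)
definition cond_num :: "complex mat \<Rightarrow> complex \<Rightarrow> real" where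
  "cond_num A k =
     (THE c. \<exists>u v. eigenvector A u k \<and> left_eigenvector A v k \<and>
        c = l2_norm_vec u * l2_norm_vec v / cmod (conjugate v \<bullet> u))"

end

theory Submission
  imports Defs "Jordan_Normal_Form.Jordan_Normal_Form_Uniqueness"
begin

text \<open>
  Put \<open>y\<^sub>i = J x\<^sub>i\<close> and \<open>c = x\<^sub>1\<^sup>T J x\<^sub>2\<close>. Multiplying \<open>S x = k x\<close> by \<open>S\<^sup>T J\<close> and using
  \<open>S\<^sup>T J S = J\<close> gives \<open>S\<^sup>T (J x) = k\<^sup>-\<^sup>1 (J x)\<close> (lemma \<open>symplectic_eigenvector_dual\<close>), so \<open>y\<^sub>1\<close> and
  \<open>y\<^sub>2\<close> are eigenvectors of \<open>S\<^sup>T\<close> for \<open>\<lambda>\<^sup>-\<^sup>1\<close> and \<open>\<lambda>\<close>. Everything follows from this duality.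

  The update. For an antidiagonal \<open>R\<close> with entries \<open>a\<close>, \<open>b\<close>, the matrix \<open>X R X\<^sup>T\<close> is a combination of
  \<open>x\<^sub>1 x\<^sub>2\<^sup>T\<close> and \<open>x\<^sub>2 x\<^sub>1\<^sup>T\<close>, and multiplying it by \<open>J\<^sup>T S\<close> on the right turns the row vectors into
  multiples of \<open>y\<^sub>2\<^sup>T\<close> and \<open>y\<^sub>1\<^sup>T\<close>. Hence the update is \<open>p x\<^sub>1 y\<^sub>2\<^sup>T + q x\<^sub>2 y\<^sub>1\<^sup>T\<close> with
  \<open>p = a \<lambda> / c\<close> and \<open>q = b / (\<lambda> c)\<close> (lemma \<open>antidiagonal_update_eq\<close>). Since \<open>J\<close> is an isometry,
  both summands have unit vectors as factors, and their Frobenius inner product is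
  \<open>p q\<^sup>* |x\<^sub>2\<^sup>H x\<^sub>1|\<^sup>2\<close>. So the squared norm is \<open>|p|\<^sup>2 + |q|\<^sup>2 + 2 t Re (p q\<^sup>*)\<close> with
  \<open>t = |x\<^sub>2\<^sup>H x\<^sub>1|\<^sup>2\<close> in \<open>[0, 1]\<close> by Cauchy--Schwarz. This expression is affine in \<open>t\<close>, equal to
  \<open>|p + q|\<^sup>2\<close> at \<open>t = 1\<close> and to \<open>|p - q|\<^sup>2\<close> at \<open>t = -1\<close>, so the norm lies between \<open>|p + q|\<close> and \<open>|p - q|\<close>;
  the sign of the slope \<open>2 Re (p q\<^sup>*)\<close> decides which of the two is the upper bound. For both choices
  of \<open>R\<close> this sign is that of the real part named in the theorem, and dividing \<open>|p + q|\<close> and \<open>|p - q|\<close> by the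
  norm of \<open>S\<close> gives the stated bounds.

  The condition number. Duality makes the conjugate of \<open>y\<^sub>2\<close> a unit left eigenvector for \<open>\<lambda>\<close>, and its inner
  product with \<open>x\<^sub>1\<close> is \<open>c\<close>. It remains that the quotient defining the condition number does not depend on
  the eigenvectors chosen. This holds because the eigenspace of a simple eigenvalue is a line: its
  dimension counts the Jordan blocks for the eigenvalue, whose sizes add up to the algebraic multiplicity.
\<close>

section \<open>Simple eigenvalues and condition numbers\<close>

text \<open>Each Jordan block for \<open>k\<close> adds one to the dimension of the eigenspace and its size, at least one,
  to the algebraic multiplicity.\<close>

lemma simple_eigenvalue_kernel_dim_le_1:
  assumes A: "A \<in> carrier_mat n n" and simple: "simple_eigenvalue A k"
  shows "kernel_dim (char_matrix A k) \<le> 1"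
proof -
  obtain n_as where jnf: "jordan_nf A n_as"
    using char_poly_factorized[OF A] jordan_nf_exists[OF A] by blast
  have eq: "filter (\<lambda>na. snd na = k) n_as = [(n, e)\<leftarrow>n_as . e = k]"
    by (intro filter_cong) auto
  have "kernel_dim (char_matrix A k ^\<^sub>m 1) = (\<Sum>n \<leftarrow> map fst [(n, e)\<leftarrow>n_as . e = k]. min 1 n)"
    using dim_gen_eigenspace[OF jnf, of k 1] unfolding dim_gen_eigenspace_def .
  also have "\<dots> \<le> (\<Sum>n \<leftarrow> map fst [(n, e)\<leftarrow>n_as . e = k]. n)"
    by (intro sum_list_mono) auto
  also have "\<dots> = Polynomial.order k (char_poly A)"
    unfolding jordan_nf_order[OF jnf] eq by simp
  also have "\<dots> = 1"
    using simple by (simp add: simple_eigenvalue_def)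
  finally show ?thesis
    using A by simp
qed

lemma simple_eigenvalue_eigenvectors_proportional:
  assumes A: "A \<in> carrier_mat n n" and simple: "simple_eigenvalue A k"
    and u: "eigenvector A u k" and w: "eigenvector A w k"
  obtains a where "a \<noteq> 0" "w = a \<cdot>\<^sub>v u"
proof -
  define C where "C = char_matrix A k"
  have C: "C \<in> carrier_mat n n" unfolding C_def using A by simp
  interpret K: kernel n n C by unfold_locales (rule C)
  from kernel_basis_exists[OF C] obtain B where fin: "finite B" and B: "K.basis B" by blast
  have "card B = kernel_dim C"
    using K.Ker.dim_basis[OF fin B] C by simp
  also have "\<dots> \<le> 1"
    unfolding C_def by (rule simple_eigenvalue_kernel_dim_le_1[OF A simple])
  finally have "card B \<le> 1" .
  then obtain b where b: "B \<subseteq> {b}"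
    using fin by (metis card_le_Suc0_iff_eq One_nat_def empty_subsetI insertI1 subsetI equals0I singletonD)
  have BK: "B \<subseteq> mat_kernel C" using B unfolding K.Ker.basis_def by auto
  have rep: "\<exists>a. v = a \<cdot>\<^sub>v b" if "eigenvector A v k" for v
  proof -
    have v: "v \<in> carrier_vec n" "v \<noteq> 0\<^sub>v n" "v \<in> mat_kernel C"
      using that unfolding eigenvector_char_matrix[OF A] C_def[symmetric]
      by (auto intro: mat_kernelI[OF C])
    have "v \<in> K.span B"
      using B v unfolding K.Ker.basis_def by auto
    then obtain a U where U: "U \<subseteq> B" and va: "v = K.lincomb a U" 
      unfolding K.Ker.span_def by auto
    have "U = {} \<or> U = {b}" using U b by auto
    moreover have "K.lincomb a {} = 0\<^sub>v n" by (simp add: K.Ker.lincomb_def)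
    ultimately have Ub: "U = {b}" using v va by auto
    hence bK: "b \<in> mat_kernel C" using U BK by auto
    have "K.lincomb a {b} = a b \<cdot>\<^sub>v b"
      using bK K.Ker.smult_closed[of "a b" b] by (simp add: K.Ker.lincomb_def)
    thus ?thesis using va Ub by auto
  qed
  obtain p q where p: "u = p \<cdot>\<^sub>v b" and q: "w = q \<cdot>\<^sub>v b"
    using rep[OF u] rep[OF w] by blast
  have nz: "u \<noteq> 0\<^sub>v n" "w \<noteq> 0\<^sub>v n" "u \<in> carrier_vec n" "w \<in> carrier_vec n"
    using u w A unfolding eigenvector_def by auto
  have bn: "b \<in> carrier_vec n" using nz(3) unfolding p by simp
  have "p \<noteq> 0" "q \<noteq> 0" using nz(1,2) bn unfolding p q by auto
  then show thesis
    unfolding p q by (intro that[of "q / p"]) (simp_all add: p q smult_smult_assoc)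
qed

text \<open>Reduces left eigenvectors to right ones; the conjugate enters because a left eigenvector \<open>v\<close> acts
  through \<open>v\<^sup>H\<close>, not \<open>v\<^sup>T\<close>.\<close>

lemma left_eigenvector_iff:
  assumes A: "A \<in> carrier_mat n n"
  shows "left_eigenvector A v k \<longleftrightarrow> eigenvector (transpose_mat A) (conjugate v) k"
proof (cases "v \<in> carrier_vec n")
  case v: True
  let ?row = "\<lambda>w :: complex vec. mat 1 n (\<lambda>(i, j). w $ j)"
  have inj: "?row w = ?row w' \<longleftrightarrow> w = w'"
    if "w \<in> carrier_vec n" "w' \<in> carrier_vec n" for w w'
  proof
    assume eq: "?row w = ?row w'"
    show "w = w'"
    proof (rule eq_vecI)
      fix j assume "j < dim_vec w'"
      then have "j < n" using that by simp
      then show "w $ j = w' $ j" using arg_cong[OF eq, of "\<lambda>M. M $$ (0, j)"] by simp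
    qed (use that in simp)
  qed simp
  have carriers: "transpose_mat A *\<^sub>v conjugate v \<in> carrier_vec n" "k \<cdot>\<^sub>v conjugate v \<in> carrier_vec n"
    using A v by (auto intro!: carrier_vecI)
  have "adjoint_row v * A = ?row (transpose_mat A *\<^sub>v conjugate v)"
    using A v
    by (intro eq_matI) (simp_all add: adjoint_row_def mat_of_rows_index scalar_prod_def mult.commute)
  moreover have "k \<cdot>\<^sub>m adjoint_row v = ?row (k \<cdot>\<^sub>v conjugate v)"
    using v by (intro eq_matI) (simp_all add: adjoint_row_def mat_of_rows_index)
  moreover note inj[OF carriers]
  ultimately have "adjoint_row v * A = k \<cdot>\<^sub>m adjoint_row v
      \<longleftrightarrow> transpose_mat A *\<^sub>v conjugate v = k \<cdot>\<^sub>v conjugate v"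
    by (simp only:)
  then show ?thesis
    using A v by (simp add: left_eigenvector_def eigenvector_def)
next
  case False
  then have "conjugate v \<notin> carrier_vec n"
    by (metis carrier_vecD carrier_vecI dim_vec_conjugate)
  with False show ?thesis using A by (simp add: left_eigenvector_def eigenvector_def)
qed

lemma l2_norm_vec_smult: "l2_norm_vec (a \<cdot>\<^sub>v u) = cmod a * l2_norm_vec u"
  by (simp add: l2_norm_vec_def norm_mult power_mult_distrib real_sqrt_mult flip: sum_distrib_left)

lemma l2_norm_vec_conjugate [simp]: "l2_norm_vec (conjugate v) = l2_norm_vec v"
  by (simp add: l2_norm_vec_def)

text \<open>The quotient is invariant under rescaling either eigenvector, and for a simple eigenvalue the left and
  right eigenvectors are unique up to rescaling; so the definite description can be evaluated at any pair.\<close>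

lemma cond_num_eq:
  assumes A: "A \<in> carrier_mat n n" and simple: "simple_eigenvalue A k"
    and u: "eigenvector A u k" and v: "left_eigenvector A v k"
  shows "cond_num A k = l2_norm_vec u * l2_norm_vec v / cmod (conjugate v \<bullet> u)"
  unfolding cond_num_def
proof (rule the_equality)
  show "\<exists>u' v'. eigenvector A u' k \<and> left_eigenvector A v' k \<and>
      l2_norm_vec u * l2_norm_vec v / cmod (conjugate v \<bullet> u)
        = l2_norm_vec u' * l2_norm_vec v' / cmod (conjugate v' \<bullet> u')"
    using u v by blast
next
  fix c
  assume "\<exists>u' v'. eigenvector A u' k \<and> left_eigenvector A v' k \<and>
      c = l2_norm_vec u' * l2_norm_vec v' / cmod (conjugate v' \<bullet> u')"
  then obtain u' v' where u': "eigenvector A u' k" and v': "left_eigenvector A v' k"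
    and c: "c = l2_norm_vec u' * l2_norm_vec v' / cmod (conjugate v' \<bullet> u')" by blast
  have At: "transpose_mat A \<in> carrier_mat n n" using A by simp
  have simplet: "simple_eigenvalue (transpose_mat A) k"
    using simple A by (simp add: simple_eigenvalue_def)
  obtain a where a: "a \<noteq> 0" "u' = a \<cdot>\<^sub>v u"
    by (rule simple_eigenvalue_eigenvectors_proportional[OF A simple u u'])
  obtain b where b: "b \<noteq> 0" "conjugate v' = b \<cdot>\<^sub>v conjugate v"
    by (rule simple_eigenvalue_eigenvectors_proportional[OF At simplet
          v[unfolded left_eigenvector_iff[OF A]] v'[unfolded left_eigenvector_iff[OF A]]])
  have dims: "u \<in> carrier_vec n" "v \<in> carrier_vec n"
    using u v A by (auto simp: eigenvector_def left_eigenvector_def)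
  have nu: "l2_norm_vec u' = cmod a * l2_norm_vec u"
    unfolding a(2) by (rule l2_norm_vec_smult)
  have nv: "l2_norm_vec v' = cmod b * l2_norm_vec v"
    using arg_cong[OF b(2), of l2_norm_vec] by (simp only: l2_norm_vec_smult l2_norm_vec_conjugate)
  have "conjugate v' \<bullet> u' = b * a * (conjugate v \<bullet> u)"
    using dims unfolding a(2) b(2) by simp
  then have "c = (cmod a * cmod b) * (l2_norm_vec u * l2_norm_vec v)
      / ((cmod a * cmod b) * cmod (conjugate v \<bullet> u))"
    unfolding c nu nv by (simp only: norm_mult mult_ac)
  then show "c = l2_norm_vec u * l2_norm_vec v / cmod (conjugate v \<bullet> u)"
    using a(1) b(1) by (simp only: mult_divide_mult_cancel_left mult_eq_0_iff norm_eq_zero simp_thms)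
qed

section \<open>The matrix \<open>J\<close> and eigenvectors of symplectic matrices\<close>

lemma symp_J_carrier [simp]: "symp_J n \<in> carrier_mat (2 * n) (2 * n)"
  by (simp add: symp_J_def mult_2)

lemma symp_J_dim [simp]: "dim_row (symp_J n) = 2 * n" "dim_col (symp_J n) = 2 * n"
  by (simp_all add: symp_J_def)

lemma symp_J_mult_vec_carrier [simp]:
  "x \<in> carrier_vec (2 * n) \<Longrightarrow> symp_J n *\<^sub>v x \<in> carrier_vec (2 * n)"
  by (rule mult_mat_vec_carrier[OF symp_J_carrier])

lemma symp_J_mult_vec_index:
  assumes x: "x \<in> carrier_vec (2 * n)" and i: "i < 2 * n"
  shows "(symp_J n *\<^sub>v x) $ i = (if i < n then x $ (i + n) else - x $ (i - n))"
proof -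
  have "(symp_J n *\<^sub>v x) $ i = (\<Sum>j<2*n. symp_J n $$ (i, j) * x $ j)"
    using x i by (auto simp: scalar_prod_def atLeast0LessThan intro!: sum.cong)
  also have "\<dots> = (\<Sum>j<2*n. if j = (if i < n then i + n else i - n) then
      (if i < n then x $ j else - x $ j) else 0)"
    using i by (intro sum.cong) (auto simp: symp_J_def)
  finally show ?thesis using i by (cases "i < n") auto
qed

text \<open>\<open>J\<close> only swaps the two halves of a vector and changes the sign of one of them.\<close>

lemma symp_J_isometry:
  assumes x: "x \<in> carrier_vec (2 * n)" and z: "z \<in> carrier_vec (2 * n)"
  shows "(symp_J n *\<^sub>v x) \<bullet> conjugate (symp_J n *\<^sub>v z) = x \<bullet> conjugate z"
proof -
  have "(\<Sum>i<n + m. f i) = (\<Sum>i<n. f i) + (\<Sum>i<m. f (i + n))" for f :: "nat \<Rightarrow> complex" and m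
    by (induction m) (simp_all add: add.commute)
  note split = this[of _ n, folded mult_2]
  have "(symp_J n *\<^sub>v x) \<bullet> conjugate (symp_J n *\<^sub>v z)
      = (\<Sum>i<2*n. (symp_J n *\<^sub>v x) $ i * cnj ((symp_J n *\<^sub>v z) $ i))"
    using x z by (auto simp: scalar_prod_def atLeast0LessThan simp del: index_mult_mat_vec)
  also have "\<dots> = (\<Sum>i<2*n. x $ i * cnj (z $ i))"
    unfolding split using x z by (simp add: symp_J_mult_vec_index del: index_mult_mat_vec)
  also have "\<dots> = x \<bullet> conjugate z"
    using z by (auto simp: scalar_prod_def atLeast0LessThan intro!: sum.cong)
  finally show ?thesis .
qed

lemma l2_norm_vec_square: "complex_of_real ((l2_norm_vec v)\<^sup>2) = v \<bullet> conjugate v"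
  by (simp add: l2_norm_vec_def sum_nonneg scalar_prod_def atLeast0LessThan complex_norm_square
      del: of_real_power)

lemma l2_norm_symp_J:
  assumes x: "x \<in> carrier_vec (2 * n)"
  shows "l2_norm_vec (symp_J n *\<^sub>v x) = l2_norm_vec x"
proof -
  have "complex_of_real ((l2_norm_vec (symp_J n *\<^sub>v x))\<^sup>2) = complex_of_real ((l2_norm_vec x)\<^sup>2)"
    unfolding l2_norm_vec_square by (rule symp_J_isometry[OF x x])
  then have "(l2_norm_vec (symp_J n *\<^sub>v x))\<^sup>2 = (l2_norm_vec x)\<^sup>2"
    by (simp only: of_real_eq_iff)
  moreover have "l2_norm_vec v \<ge> 0" for v by (simp add: l2_norm_vec_def sum_nonneg)
  ultimately show ?thesis by (simp add: power2_eq_iff_nonneg)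
qed

lemma symplectic_carrier: "symplectic n S \<Longrightarrow> S \<in> carrier_mat (2 * n) (2 * n)"
  by (simp add: symplectic_def)

text \<open>Apply \<open>S\<^sup>T J S = J\<close> to the eigenvector: \<open>J x = S\<^sup>T J (S x) = k S\<^sup>T (J x)\<close>. For \<open>k = 0\<close> this would give
  \<open>J x = 0\<close>, hence \<open>x = 0\<close>.\<close>

lemma symplectic_eigenvector_dual:
  assumes S: "symplectic n S" and x: "eigenvector S x k"
  shows "k \<noteq> 0"
    and "transpose_mat S *\<^sub>v (symp_J n *\<^sub>v x) = inverse k \<cdot>\<^sub>v (symp_J n *\<^sub>v x)"
proof -
  note Sc = symplectic_carrier[OF S]
  have xc: "x \<in> carrier_vec (2 * n)" "x \<noteq> 0\<^sub>v (2 * n)" and Sx: "S *\<^sub>v x = k \<cdot>\<^sub>v x"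
    using x Sc by (auto simp: eigenvector_def)
  let ?y = "symp_J n *\<^sub>v x"
  have yc: "?y \<in> carrier_vec (2 * n)" using xc by simp
  have "?y = transpose_mat S * symp_J n * S *\<^sub>v x"
    using S by (simp add: symplectic_def)
  also have "\<dots> = transpose_mat S *\<^sub>v (symp_J n *\<^sub>v (S *\<^sub>v x))"
    using Sc xc symp_J_carrier[of n] by (simp add: assoc_mult_mat_vec[of _ "2*n" "2*n" _ "2*n"])
  also have "\<dots> = k \<cdot>\<^sub>v (transpose_mat S *\<^sub>v ?y)"
    unfolding Sx using Sc xc symp_J_carrier[of n] yc
    by (simp add: mult_mat_vec[of _ "2*n" "2*n"])
  finally have y: "?y = k \<cdot>\<^sub>v (transpose_mat S *\<^sub>v ?y)" .
  show k: "k \<noteq> 0"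
  proof
    assume "k = 0"
    have "?y = 0 \<cdot>\<^sub>v (transpose_mat S *\<^sub>v ?y)"
      by (rule y[unfolded \<open>k = 0\<close>])
    also have "\<dots> = 0\<^sub>v (2 * n)"
      using Sc by (intro eq_vecI) auto
    finally have "?y = 0\<^sub>v (2 * n)" .
    then have "x \<bullet> conjugate x = 0"
      using symp_J_isometry[OF xc(1) xc(1)] by simp
    then show False using xc by simp
  qed
  have "inverse k \<cdot>\<^sub>v ?y = inverse k \<cdot>\<^sub>v (k \<cdot>\<^sub>v (transpose_mat S *\<^sub>v ?y))"
    by (rule arg_cong[OF y, of "(\<cdot>\<^sub>v) (inverse k)"])
  also have "\<dots> = transpose_mat S *\<^sub>v ?y"
    using k by (simp add: smult_smult_assoc)
  finally show "transpose_mat S *\<^sub>v ?y = inverse k \<cdot>\<^sub>v ?y" ..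
qed

section \<open>Outer products and their Frobenius norms\<close>

definition outer_prod :: "complex vec \<Rightarrow> complex vec \<Rightarrow> complex mat" where
  "outer_prod u v = mat (dim_vec u) (dim_vec v) (\<lambda>(i, j). u $ i * v $ j)"

lemma outer_prod_carrier [simp]:
  "u \<in> carrier_vec m \<Longrightarrow> v \<in> carrier_vec n \<Longrightarrow> outer_prod u v \<in> carrier_mat m n"
  by (auto simp: outer_prod_def)

lemma outer_prod_mult:
  assumes "v \<in> carrier_vec m" "A \<in> carrier_mat m n"
  shows "outer_prod u v * A = outer_prod u (transpose_mat A *\<^sub>v v)"
  using assms
  by (intro eq_matI) (auto simp: outer_prod_def scalar_prod_def sum_distrib_left mult_ac)

lemma outer_prod_smult_right: "outer_prod u (k \<cdot>\<^sub>v v) = k \<cdot>\<^sub>m outer_prod u v"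
  by (intro eq_matI) (auto simp: outer_prod_def)

text \<open>The Frobenius inner product of \<open>u v\<^sup>T\<close> and \<open>w z\<^sup>T\<close> factors into the inner products of their vectors;
  this is the expansion of a squared norm in the corresponding inner product space.\<close>

lemma frob_norm_two_outer_prods:
  assumes "u \<in> carrier_vec m" "w \<in> carrier_vec m" "v \<in> carrier_vec n" "z \<in> carrier_vec n"
  shows "(frob_norm (p \<cdot>\<^sub>m outer_prod u v + q \<cdot>\<^sub>m outer_prod w z))\<^sup>2
    = (cmod p * l2_norm_vec u * l2_norm_vec v)\<^sup>2 + (cmod q * l2_norm_vec w * l2_norm_vec z)\<^sup>2
      + 2 * Re (p * cnj q * ((u \<bullet> conjugate w) * (v \<bullet> conjugate z)))"
proof -
  have sq: "(cmod (a + b))\<^sup>2 = (cmod a)\<^sup>2 + (cmod b)\<^sup>2 + 2 * Re (a * cnj b)" for a b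
    unfolding cmod_power2 by (simp add: power2_eq_square algebra_simps)
  have entry: "(cmod (p * (u $ i * v $ j) + q * (w $ i * z $ j)))\<^sup>2
      = (cmod p)\<^sup>2 * ((cmod (u $ i))\<^sup>2 * (cmod (v $ j))\<^sup>2)
        + (cmod q)\<^sup>2 * ((cmod (w $ i))\<^sup>2 * (cmod (z $ j))\<^sup>2)
        + 2 * Re (p * cnj q * ((u $ i * cnj (w $ i)) * (v $ j * cnj (z $ j))))" for i j
  proof -
    have "p * (u $ i * v $ j) * cnj (q * (w $ i * z $ j))
        = p * cnj q * ((u $ i * cnj (w $ i)) * (v $ j * cnj (z $ j)))"
      by (simp only: complex_cnj_mult mult_ac)
    then show ?thesis
      by (simp only: sq norm_mult power_mult_distrib)
  qed
  have "(frob_norm (p \<cdot>\<^sub>m outer_prod u v + q \<cdot>\<^sub>m outer_prod w z))\<^sup>2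
    = (\<Sum>i<m. \<Sum>j<n. (cmod (p * (u $ i * v $ j) + q * (w $ i * z $ j)))\<^sup>2)"
    using assms by (simp add: frob_norm_def outer_prod_def sum_nonneg)
  also have "\<dots> = (\<Sum>i<m. \<Sum>j<n. (cmod p)\<^sup>2 * ((cmod (u $ i))\<^sup>2 * (cmod (v $ j))\<^sup>2))
      + (\<Sum>i<m. \<Sum>j<n. (cmod q)\<^sup>2 * ((cmod (w $ i))\<^sup>2 * (cmod (z $ j))\<^sup>2))
      + 2 * Re (\<Sum>i<m. \<Sum>j<n. p * cnj q * ((u $ i * cnj (w $ i)) * (v $ j * cnj (z $ j))))"
    by (simp only: entry sum.distrib Re_sum sum_distrib_left)
  also have "\<dots> = (cmod p)\<^sup>2 * ((\<Sum>i<m. (cmod (u $ i))\<^sup>2) * (\<Sum>j<n. (cmod (v $ j))\<^sup>2))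
      + (cmod q)\<^sup>2 * ((\<Sum>i<m. (cmod (w $ i))\<^sup>2) * (\<Sum>j<n. (cmod (z $ j))\<^sup>2))
      + 2 * Re (p * cnj q * ((\<Sum>i<m. u $ i * cnj (w $ i)) * (\<Sum>j<n. v $ j * cnj (z $ j))))"
    unfolding sum_product by (simp only: sum_distrib_left)
  finally show ?thesis
    using assms
    by (simp add: l2_norm_vec_def scalar_prod_def power_mult_distrib sum_nonneg atLeast0LessThan mult.assoc)
qed

text \<open>Cauchy--Schwarz; for unit vectors the termwise inequality \<open>2 |a| |b| \<le> |a|\<^sup>2 + |b|\<^sup>2\<close> suffices.\<close>

lemma unit_scalar_prod_le_1:
  assumes "u \<in> carrier_vec n" "w \<in> carrier_vec n" "l2_norm_vec u = 1" "l2_norm_vec w = 1"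
  shows "cmod (u \<bullet> conjugate w) \<le> 1"
proof -
  have *: "(\<Sum>i<n. (cmod (u $ i))\<^sup>2) = 1" "(\<Sum>i<n. (cmod (w $ i))\<^sup>2) = 1"
    using assms by (auto simp: l2_norm_vec_def)
  have "cmod (u \<bullet> conjugate w) \<le> (\<Sum>i<n. cmod (u $ i * cnj (w $ i)))"
    using assms by (simp add: scalar_prod_def atLeast0LessThan norm_sum)
  also have "\<dots> \<le> (\<Sum>i<n. ((cmod (u $ i))\<^sup>2 + (cmod (w $ i))\<^sup>2) / 2)"
  proof (rule sum_mono)
    fix i
    show "cmod (u $ i * cnj (w $ i)) \<le> ((cmod (u $ i))\<^sup>2 + (cmod (w $ i))\<^sup>2) / 2"
      unfolding norm_mult complex_mod_cnj
      using sum_squares_bound[of "cmod (u $ i)" "cmod (w $ i)"] by (simp add: field_simps)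
  qed
  also have "\<dots> = 1"
    by (simp add: sum.distrib * flip: sum_divide_distrib)
  finally show ?thesis .
qed

text \<open>The value of \<open>F\<^sup>2\<close> at \<open>t = 1\<close> is \<open>|p + q|\<^sup>2\<close>, while \<open>|p - q|\<^sup>2\<close> is its value at \<open>t = -1\<close>; as a function of
  \<open>t\<close> it is affine with slope \<open>2 Re (p q\<^sup>*)\<close>.\<close>

lemma norm_between_sum_and_difference:
  assumes F: "F \<ge> 0" "F\<^sup>2 = (cmod p)\<^sup>2 + (cmod q)\<^sup>2 + 2 * (t * Re (p * cnj q))"
    and t: "0 \<le> t" "t \<le> 1"
  shows "Re (p * cnj q) \<le> 0 \<Longrightarrow> cmod (p + q) \<le> F \<and> F \<le> cmod (p - q)"
    and "Re (p * cnj q) \<ge> 0 \<Longrightarrow> cmod (p - q) \<le> F \<and> F \<le> cmod (p + q)"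
proof -
  define r where "r = Re (p * cnj q)"
  have sum: "(cmod (p + q))\<^sup>2 = (cmod p)\<^sup>2 + (cmod q)\<^sup>2 + 2 * r"
    and diff: "(cmod (p - q))\<^sup>2 = (cmod p)\<^sup>2 + (cmod q)\<^sup>2 - 2 * r"
    unfolding cmod_power2 r_def by (simp_all add: power2_eq_square algebra_simps)
  have F2: "F\<^sup>2 = (cmod p)\<^sup>2 + (cmod q)\<^sup>2 + 2 * (t * r)"
    using F(2) unfolding r_def .
  show "cmod (p + q) \<le> F \<and> F \<le> cmod (p - q)" if "Re (p * cnj q) \<le> 0"
  proof -
    have r: "r \<le> 0" using that unfolding r_def .
    have "t * r \<le> 0" "r \<le> t * r"
      using r t mult_nonneg_nonpos[of t r] mult_left_le_one_le[of "- r" t] by auto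
    then have "(cmod (p + q))\<^sup>2 \<le> F\<^sup>2" "F\<^sup>2 \<le> (cmod (p - q))\<^sup>2"
      unfolding F2 sum diff using r by linarith+
    then show ?thesis
      using F(1) by (auto intro: power2_le_imp_le)
  qed
  show "cmod (p - q) \<le> F \<and> F \<le> cmod (p + q)" if "Re (p * cnj q) \<ge> 0"
  proof -
    have r: "r \<ge> 0" using that unfolding r_def .
    have "0 \<le> t * r" "t * r \<le> r"
      using r t mult_nonneg_nonneg[of t r] mult_left_le_one_le[of r t] by auto
    then have "(cmod (p - q))\<^sup>2 \<le> F\<^sup>2" "F\<^sup>2 \<le> (cmod (p + q))\<^sup>2"
      unfolding F2 sum diff using r by linarith+
    then show ?thesis
      using F(1) by (auto intro: power2_le_imp_le)
  qed
qed

section \<open>Antidiagonal updates of a symplectic matrix\<close>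

lemma antidiagonal_congruence:
  assumes x1: "x1 \<in> carrier_vec m" and x2: "x2 \<in> carrier_vec m"
    and X: "X = k \<cdot>\<^sub>m mat_of_cols m [x1, x2]"
    and R: "R = mat_of_rows_list 2 [[0, a], [b, 0]]"
  shows "X * R * transpose_mat X
    = (k\<^sup>2 * a) \<cdot>\<^sub>m outer_prod x1 x2 + (k\<^sup>2 * b) \<cdot>\<^sub>m outer_prod x2 x1"
  using x1 x2 unfolding X R
  by (intro eq_matI)
    (auto simp: outer_prod_def scalar_prod_def mat_of_rows_list_def mat_of_cols_def
      numeral_2_eq_2 algebra_simps)

text \<open>Multiplying an outer product on the right by \<open>J\<^sup>T S\<close> applies \<open>S\<^sup>T J\<close> to its second factor, and
  \<open>S\<^sup>T J\<close> maps \<open>x\<^sub>1\<close> and \<open>x\<^sub>2\<close> to multiples of \<open>J x\<^sub>1\<close> and \<open>J x\<^sub>2\<close>. The update thus has rank at most two.\<close>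

lemma antidiagonal_update_eq:
  assumes S: "symplectic n S"
    and x1: "eigenvector S x1 lam" and x2: "eigenvector S x2 (inverse lam)"
    and X: "X = k \<cdot>\<^sub>m mat_of_cols (2 * n) [x1, x2]"
    and R: "R = mat_of_rows_list 2 [[0, a], [b, 0]]"
  shows "X * R * transpose_mat X * transpose_mat (symp_J n) * S
    = (k\<^sup>2 * a * lam) \<cdot>\<^sub>m outer_prod x1 (symp_J n *\<^sub>v x2)
      + (k\<^sup>2 * b * inverse lam) \<cdot>\<^sub>m outer_prod x2 (symp_J n *\<^sub>v x1)"
proof -
  let ?N = "2 * n" and ?J = "symp_J n"
  note Sc = symplectic_carrier[OF S]
  have c1: "x1 \<in> carrier_vec ?N" and c2: "x2 \<in> carrier_vec ?N"
    using x1 x2 Sc by (auto simp: eigenvector_def)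
  have M: "transpose_mat ?J * S \<in> carrier_mat ?N ?N"
    using Sc by (intro mult_carrier_mat[of _ ?N ?N]) simp_all
  have act: "outer_prod u v * (transpose_mat ?J * S) = outer_prod u (transpose_mat S *\<^sub>v (?J *\<^sub>v v))"
    if v: "v \<in> carrier_vec ?N" for u v
  proof -
    have "transpose_mat (transpose_mat ?J * S) *\<^sub>v v = (transpose_mat S * ?J) *\<^sub>v v"
      using Sc by (subst transpose_mult[of _ ?N ?N _ ?N]) auto
    also have "\<dots> = transpose_mat S *\<^sub>v (?J *\<^sub>v v)"
      using Sc v by (intro assoc_mult_mat_vec[of _ ?N ?N _ ?N]) auto
    finally show ?thesis
      by (simp add: outer_prod_mult[OF v M])
  qed
  have smult_smult: "c \<cdot>\<^sub>m (d \<cdot>\<^sub>m A) = (c * d) \<cdot>\<^sub>m A" for c d :: complex and A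
    by (intro eq_matI) auto
  have "X * R * transpose_mat X * transpose_mat ?J * S = X * R * transpose_mat X * (transpose_mat ?J * S)"
    using Sc by (intro assoc_mult_mat[of _ ?N ?N _ ?N _ ?N]) (auto intro!: carrier_matI simp: X)
  also have "\<dots> = (k\<^sup>2 * a) \<cdot>\<^sub>m (outer_prod x1 x2 * (transpose_mat ?J * S))
      + (k\<^sup>2 * b) \<cdot>\<^sub>m (outer_prod x2 x1 * (transpose_mat ?J * S))"
    unfolding antidiagonal_congruence[OF c1 c2 X R]
    using c1 c2 M
    by (subst add_mult_distrib_mat[of _ ?N ?N _ _ ?N]) (auto simp: mult_smult_assoc_mat[of _ ?N ?N _ ?N])
  also have "\<dots> = (k\<^sup>2 * a * lam) \<cdot>\<^sub>m outer_prod x1 (?J *\<^sub>v x2)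
      + (k\<^sup>2 * b * inverse lam) \<cdot>\<^sub>m outer_prod x2 (?J *\<^sub>v x1)"
    unfolding act[OF c1] act[OF c2] symplectic_eigenvector_dual(2)[OF S x1]
      symplectic_eigenvector_dual(2)[OF S x2]
    unfolding outer_prod_smult_right inverse_inverse_eq by (simp only: smult_smult)
  finally show ?thesis .
qed

text \<open>The two coefficients of the update are written with a common factor \<open>g\<close> because \<open>g w (g z)\<^sup>* = |g|\<^sup>2 w z\<^sup>*\<close>:
  the case distinction then depends on \<open>w\<close> and \<open>z\<close> alone. The theorem uses \<open>(w, z) = (\<lambda> \<mu>, 1)\<close> and
  \<open>(w, z) = (\<lambda>, \<mu>)\<close>.\<close>

lemma antidiagonal_update_frob_norm_bounds:
  assumes S: "symplectic n S"
    and x1: "eigenvector S x1 lam" and x2: "eigenvector S x2 (inverse lam)"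
    and unit: "l2_norm_vec x1 = 1" "l2_norm_vec x2 = 1"
    and X: "X = k \<cdot>\<^sub>m mat_of_cols (2 * n) [x1, x2]"
    and R: "R = mat_of_rows_list 2 [[0, a], [b, 0]]"
    and S': "S' = S + X * R * transpose_mat X * transpose_mat (symp_J n) * S"
    and a: "k\<^sup>2 * a * lam = g * w" and b: "k\<^sup>2 * b * inverse lam = g * z"
  shows "Re (w * cnj z) \<le> 0 \<Longrightarrow>
      cmod g * cmod (w + z) \<le> frob_norm (S' - S) \<and> frob_norm (S' - S) \<le> cmod g * cmod (w - z)"
    and "Re (w * cnj z) \<ge> 0 \<Longrightarrow>
      cmod g * cmod (w - z) \<le> frob_norm (S' - S) \<and> frob_norm (S' - S) \<le> cmod g * cmod (w + z)"
proof -
  let ?N = "2 * n" and ?J = "symp_J n"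
  note Sc = symplectic_carrier[OF S]
  have c1: "x1 \<in> carrier_vec ?N" and c2: "x2 \<in> carrier_vec ?N"
    using x1 x2 Sc by (auto simp: eigenvector_def)
  have Jc: "?J *\<^sub>v x1 \<in> carrier_vec ?N" "?J *\<^sub>v x2 \<in> carrier_vec ?N"
    using c1 c2 by simp_all
  define D where "D = (g * w) \<cdot>\<^sub>m outer_prod x1 (?J *\<^sub>v x2) + (g * z) \<cdot>\<^sub>m outer_prod x2 (?J *\<^sub>v x1)"
  have D: "D \<in> carrier_mat ?N ?N"
    unfolding D_def using c1 c2 Jc by simp
  have "S' = S + D"
    unfolding S' antidiagonal_update_eq[OF S x1 x2 X R] a b D_def ..
  then have diff: "S' - S = D"
    using Sc D by (intro eq_matI) auto
  \<comment> \<open>As \<open>J\<close> is an isometry, the inner product of the second factors is the conjugate of the one of the first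
    factors. Their product is therefore real and nonnegative.\<close>
  define t where "t = (cmod (x1 \<bullet> conjugate x2))\<^sup>2"
  have "x2 \<bullet> conjugate x1 = cnj (x1 \<bullet> conjugate x2)"
    using c1 c2 by (simp add: scalar_prod_def mult.commute)
  then have t: "(x1 \<bullet> conjugate x2) * ((?J *\<^sub>v x2) \<bullet> conjugate (?J *\<^sub>v x1)) = complex_of_real t"
    unfolding t_def symp_J_isometry[OF c2 c1] by (simp only: complex_norm_square)
  have "t \<le> 1"
    unfolding t_def using unit_scalar_prod_le_1[OF c1 c2 unit] by (simp add: power_le_one)
  have "(frob_norm D)\<^sup>2 = (cmod (g * w))\<^sup>2 + (cmod (g * z))\<^sup>2
      + 2 * Re (g * w * cnj (g * z) * complex_of_real t)"
    unfolding D_def frob_norm_two_outer_prods[OF c1 c2 Jc(2) Jc(1)] t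
    by (simp only: l2_norm_symp_J[OF c1] l2_norm_symp_J[OF c2] unit mult_1_right)
  moreover have "Re (v * complex_of_real t) = t * Re v" for v by simp
  ultimately have F: "(frob_norm D)\<^sup>2 = (cmod (g * w))\<^sup>2 + (cmod (g * z))\<^sup>2
      + 2 * (t * Re (g * w * cnj (g * z)))"
    by (simp only:)
  have sgn: "Re (g * w * cnj (g * z)) = (cmod g)\<^sup>2 * Re (w * cnj z)"
    unfolding cmod_power2 by (simp add: power2_eq_square algebra_simps)
  have F0: "0 \<le> frob_norm D" by (simp add: frob_norm_def sum_nonneg)
  have t0: "0 \<le> t" by (simp add: t_def)
  note between = norm_between_sum_and_difference[OF F0 F t0 \<open>t \<le> 1\<close>,
      unfolded sgn, folded distrib_left right_diff_distrib, unfolded norm_mult]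
  show "cmod g * cmod (w + z) \<le> frob_norm (S' - S) \<and> frob_norm (S' - S) \<le> cmod g * cmod (w - z)"
    if "Re (w * cnj z) \<le> 0"
    unfolding diff using that by (intro between(1) mult_nonneg_nonpos) simp_all
  show "cmod g * cmod (w - z) \<le> frob_norm (S' - S) \<and> frob_norm (S' - S) \<le> cmod g * cmod (w + z)"
    if "Re (w * cnj z) \<ge> 0"
    unfolding diff using that by (intro between(2) mult_nonneg_nonneg) simp_all
qed

text \<open>The left eigenvector is the conjugate of \<open>J x\<^sub>2\<close>: by duality \<open>J x\<^sub>2\<close> is an eigenvector of \<open>S\<^sup>T\<close> for
  \<open>\<lambda>\<close>, and as \<open>J\<close> is an isometry it has norm one.\<close>

lemma symplectic_cond_num:
  assumes S: "symplectic n S" and simple: "simple_eigenvalue S lam"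
    and x1: "eigenvector S x1 lam" and x2: "eigenvector S x2 (inverse lam)"
    and unit: "l2_norm_vec x1 = 1" "l2_norm_vec x2 = 1"
  shows "cond_num S lam = 1 / cmod (x1 \<bullet> (symp_J n *\<^sub>v x2))"
proof -
  let ?N = "2 * n" and ?y = "symp_J n *\<^sub>v x2"
  note Sc = symplectic_carrier[OF S]
  have c1: "x1 \<in> carrier_vec ?N" and c2: "x2 \<in> carrier_vec ?N" "x2 \<noteq> 0\<^sub>v ?N"
    using x1 x2 Sc by (auto simp: eigenvector_def)
  have yc: "?y \<in> carrier_vec ?N" using c2 by simp
  have norm: "l2_norm_vec ?y = 1"
    unfolding l2_norm_symp_J[OF c2(1)] by (rule unit)
  have "l2_norm_vec (0\<^sub>v ?N) = 0"
    by (simp add: l2_norm_vec_def)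
  then have "?y \<noteq> 0\<^sub>v ?N" using norm by auto
  then have "eigenvector (transpose_mat S) ?y lam"
    using Sc yc symplectic_eigenvector_dual(2)[OF S x2] by (simp add: eigenvector_def)
  then have left: "left_eigenvector S (conjugate ?y) lam"
    unfolding left_eigenvector_iff[OF Sc] by simp
  have "cond_num S lam = l2_norm_vec x1 * l2_norm_vec (conjugate ?y)
      / cmod (conjugate (conjugate ?y) \<bullet> x1)"
    by (rule cond_num_eq[OF Sc simple x1 left])
  also have "conjugate (conjugate ?y) \<bullet> x1 = x1 \<bullet> ?y"
    unfolding conjugate_id by (rule comm_scalar_prod[OF yc c1])
  finally show ?thesis
    unfolding l2_norm_vec_conjugate norm unit by simp
qed

section \<open>Relative size of the two updates\<close>

theorem theorem6:
  fixes n :: nat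
    and S X R1 R2 S1 S2 :: "complex mat"
    and x1 x2 :: "complex vec"
    and lam mu s :: complex
    and \<Phi> :: real
  assumes "symplectic n S"
    and "lam \<in> spectrum S"
    and "inverse lam \<in> spectrum S"
    and "mu \<noteq> 0"
    and "eigenvector S x1 lam"
    and "eigenvector S x2 (inverse lam)"
    and "l2_norm_vec x1 = 1"
    and "l2_norm_vec x2 = 1"
    and "x1 \<bullet> (symp_J n *\<^sub>v x2) \<noteq> 0"
    and "s\<^sup>2 = x1 \<bullet> (symp_J n *\<^sub>v x2)"
    and "X = (1 / s) \<cdot>\<^sub>m mat_of_cols (2 * n) [x1, x2]"
    and "\<Phi> = 1 / (cmod (x1 \<bullet> (symp_J n *\<^sub>v x2)) * frob_norm S)"
    and "R1 = mat_of_rows_list 2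
           [[0, inverse lam * (mu - lam)],
            [inverse mu * (mu - lam), 0]]"
    and "R2 = mat_of_rows_list 2
           [[0, inverse mu * (inverse lam - mu)],
            [lam * (inverse lam - mu), 0]]"
    and "S1 = S + X * R1 * transpose_mat X * transpose_mat (symp_J n) * S"
    and "S2 = S + X * R2 * transpose_mat X * transpose_mat (symp_J n) * S"
  shows "(simple_eigenvalue S lam \<longrightarrow> \<Phi> = cond_num S lam / frob_norm S) \<and>
    (Re (lam * mu) \<le> 0 \<longrightarrow>
       cmod (lam - mu) / cmod lam * (cmod (lam + inverse mu) * \<Phi>)
         \<le> frob_norm (S1 - S) / frob_norm S \<and>
       frob_norm (S1 - S) / frob_norm S
         \<le> cmod (lam - mu) / cmod lam * (cmod (lam - inverse mu) * \<Phi>)) \<and>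
    (Re (lam * mu) > 0 \<longrightarrow>
       cmod (lam - mu) / cmod lam * (cmod (lam - inverse mu) * \<Phi>)
         \<le> frob_norm (S1 - S) / frob_norm S \<and>
       frob_norm (S1 - S) / frob_norm S
         \<le> cmod (lam - mu) / cmod lam * (cmod (lam + inverse mu) * \<Phi>)) \<and>
    (Re (cnj lam * mu) \<le> 0 \<longrightarrow>
       cmod (inverse lam - mu) / cmod (inverse lam) * (cmod (inverse lam + inverse mu) * \<Phi>)
         \<le> frob_norm (S2 - S) / frob_norm S \<and>
       frob_norm (S2 - S) / frob_norm S
         \<le> cmod (inverse lam - mu) / cmod (inverse lam) * (cmod (inverse lam - inverse mu) * \<Phi>)) \<and>
    (Re (cnj lam * mu) > 0 \<longrightarrow>
       cmod (inverse lam - mu) / cmod (inverse lam) * (cmod (inverse lam - inverse mu) * \<Phi>)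
         \<le> frob_norm (S2 - S) / frob_norm S \<and>
       frob_norm (S2 - S) / frob_norm S
         \<le> cmod (inverse lam - mu) / cmod (inverse lam) * (cmod (inverse lam + inverse mu) * \<Phi>))"
proof -
  define c where "c = x1 \<bullet> (symp_J n *\<^sub>v x2)"
  have c: "c \<noteq> 0" and s2: "s\<^sup>2 = c"
    using assms(9,10) by (simp_all add: c_def)
  have lam: "lam \<noteq> 0"
    by (rule symplectic_eigenvector_dual(1)[OF assms(1,5)])
  have mu: "mu \<noteq> 0" by fact
  have f: "frob_norm S \<ge> 0" by (simp add: frob_norm_def sum_nonneg)
  have Phi: "\<Phi> = 1 / (cmod c * frob_norm S)"
    unfolding assms(12) c_def ..
  have cond: "simple_eigenvalue S lam \<longrightarrow> \<Phi> = cond_num S lam / frob_norm S"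
    using symplectic_cond_num[OF assms(1) _ assms(5-8)] unfolding Phi c_def by simp

  define g1 where "g1 = (mu - lam) / (c * lam * mu)"
  define g2 where "g2 = (inverse lam - mu) / (c * mu)"
  have "(1 / s)\<^sup>2 * (inverse lam * (mu - lam)) * lam = g1 * (lam * mu)"
    "(1 / s)\<^sup>2 * (inverse mu * (mu - lam)) * inverse lam = g1 * 1"
    using c lam mu by (simp_all add: g1_def power_divide s2 field_simps)
  note b1 = antidiagonal_update_frob_norm_bounds[OF assms(1,5-8,11,13,15) this,
      unfolded complex_cnj_one mult_1_right]
  have "(1 / s)\<^sup>2 * (inverse mu * (inverse lam - mu)) * lam = g2 * lam"
    "(1 / s)\<^sup>2 * (lam * (inverse lam - mu)) * inverse lam = g2 * mu"
    using c lam mu by (simp_all add: g2_def power_divide s2 field_simps)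
  note b2 = antidiagonal_update_frob_norm_bounds[OF assms(1,5-8,11,14,16) this]

  \<comment> \<open>Taking \<open>e = 1\<close> and \<open>e = -1\<close> yields the stated bounds with a plus and a minus sign.\<close>
  have id1: "cmod (lam - mu) / cmod lam * (cmod (lam + e * inverse mu) * \<Phi>)
      = cmod g1 * cmod (lam * mu + e) / frob_norm S" for e
  proof -
    have "lam + e * inverse mu = (lam * mu + e) / mu"
      using mu by (simp add: field_simps)
    then show ?thesis
      by (simp add: Phi g1_def norm_divide norm_mult norm_minus_commute)
  qed
  have id2: "cmod (inverse lam - mu) / cmod (inverse lam) * (cmod (inverse lam + e * inverse mu) * \<Phi>)
      = cmod g2 * cmod (mu + e * lam) / frob_norm S" for e
  proof -
    have "inverse lam + e * inverse mu = (mu + e * lam) / (lam * mu)"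
      using lam mu by (simp add: field_simps)
    then show ?thesis
      using lam by (simp add: Phi g2_def norm_divide norm_mult norm_inverse)
  qed
  have conj: "Re (lam * cnj mu) = Re (cnj lam * mu)" by simp
  show ?thesis
    using cond b1 b2 f id1[of 1] id1[of "- 1"] id2[of 1] id2[of "- 1"]
    unfolding conj
    by (auto intro!: divide_right_mono simp: add.commute norm_minus_commute)
qed

end
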